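(* Let $\vec{x}=(x_1,\ldots,x_t)$ be a generalized Catalan list of nonzero integers. If ${\sf cost}(\vec{x})<{\sf width}(\vec{x})$, then $\vec{x}$ is reducible.
   Context: A list $\vec{x}=(x_1,\ldots,x_t)$ of nonzero integers is generalized Catalan if $\sum_{i=1}^t x_i=0$ and $\sum_{i=1}^q x_i\ge 0$ for all $1\le q\le t$. A sublist is a list $(x_{i_1},\ldots,x_{i_a})$ with $i_1<\cdots<i_a$; the complementary sublist consists of the remaining entries in their original order. $\vec{x}$ is reducible if there is a generalized Catalan sublist whose complementary sublist is also generalized Catalan (so both are nonempty). A run is a maximal consecutive sublist of entries of the same sign; a generalized Catalan list has an even number $2y$ of runs. If $a_k>0$ is the maximum absolute value of an entry in the $k$-th run, then ${\sf cost}(\vec{x})=\sum_{k=1}^{2y}a_k$ and ${\sf width}(\vec{x})=t$. *)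

theory Defs
  imports Main
begin

definition generalized_catalan :: "int list \<Rightarrow> bool" where
  "generalized_catalan xs \<longleftrightarrow>
     xs \<noteq> [] \<and> 0 \<notin> set xs \<and> sum_list xs = 0 \<and>
     (\<forall>q\<in>{1..length xs}. sum_list (take q xs) \<ge> 0)"

text \<open>A sublist is given by its set \<open>I\<close> of (0-based) positions; the complementary
  sublist has the positions outside \<open>I\<close>.\<close>

definition reducible :: "int list \<Rightarrow> bool" where
  "reducible xs \<longleftrightarrow>
     (\<exists>I \<subseteq> {..<length xs}. generalized_catalan (nths xs I) \<and>
        generalized_catalan (nths xs ({..<length xs} - I)))"

function runs :: "int list \<Rightarrow> int list list" where
  "runs [] = []"
| "runs (x # xs) =
     (x # takeWhile (\<lambda>y. sgn y = sgn x) xs) # runs (dropWhile (\<lambda>y. sgn y = sgn x) xs)"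
  by pat_completeness auto
termination
  by (relation "measure length") (auto simp: le_imp_less_Suc length_dropWhile_le)

definition cost :: "int list \<Rightarrow> int" where
  "cost xs = (\<Sum>r\<leftarrow>runs xs. Max (abs ` set r))"

definition width :: "int list \<Rightarrow> nat" where
  "width xs = length xs"

text \<open>The following facts show that \<open>runs\<close> is the decomposition of a list into its maximal
  consecutive sublists of constant sign, and that a generalized Catalan list has an even
  number of them.\<close>

lemma concat_runs: "concat (runs xs) = xs"
  by (induction xs rule: runs.induct) auto

lemma runs_nonempty: "r \<in> set (runs xs) \<Longrightarrow> r \<noteq> []"
  by (induction xs rule: runs.induct) auto

lemma runs_same_sign: "r \<in> set (runs xs) \<Longrightarrow> x \<in> set r \<Longrightarrow> y \<in> set r \<Longrightarrow> sgn x = sgn y"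
  by (induction xs rule: runs.induct) (auto dest!: set_takeWhileD)

lemma hd_hd_runs: "xs \<noteq> [] \<Longrightarrow> runs xs \<noteq> [] \<and> hd (hd (runs xs)) = hd xs"
  by (cases xs) auto

lemma runs_maximal: "Suc k < length (runs xs) \<Longrightarrow> sgn (hd (runs xs ! Suc k)) \<noteq> sgn (hd (runs xs ! k))"
proof (induction xs arbitrary: k rule: runs.induct)
  case 1
  then show ?case by simp
next
  case (2 x xs)
  let ?d = "dropWhile (\<lambda>y. sgn y = sgn x) xs"
  show ?case
  proof (cases k)
    case 0
    with 2(2) have "runs ?d \<noteq> []" by auto
    then have "?d \<noteq> []" by (metis runs.simps(1))
    moreover from this have "sgn (hd ?d) \<noteq> sgn x" by (rule hd_dropWhile)
    ultimately show ?thesis using hd_hd_runs[of ?d] 0 by (auto simp flip: hd_conv_nth)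
  next
    case (Suc j)
    with 2 show ?thesis by simp
  qed
qed

lemma last_last_runs:
  assumes "xs \<noteq> []" shows "last (last (runs xs)) = last xs"
proof -
  from assms have ne: "runs xs \<noteq> []" using hd_hd_runs by blast
  then have "last (runs xs) \<noteq> []" using runs_nonempty last_in_set by blast
  moreover have "xs = concat (butlast (runs xs)) @ last (runs xs)"
    using concat_runs[of xs] ne by (metis append_butlast_last_id concat.simps concat_append append_Nil2)
  ultimately show ?thesis by (metis last_appendR)
qed

lemma even_length_runs:
  assumes "generalized_catalan xs" shows "even (length (runs xs))"
proof -
  from assms have ne: "xs \<noteq> []" and nz: "0 \<notin> set xs" and sm: "sum_list xs = 0"
    and pre: "\<And>q. 1 \<le> q \<Longrightarrow> q \<le> length xs \<Longrightarrow> sum_list (take q xs) \<ge> 0"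
    by (auto simp: generalized_catalan_def)
  have hd_pos: "hd xs > 0"
  proof -
    have "hd xs \<ge> 0" using pre[of 1] ne by (cases xs) auto
    moreover have "hd xs \<noteq> 0" using nz ne by (metis hd_in_set)
    ultimately show ?thesis by linarith
  qed
  have last_neg: "last xs < 0"
  proof -
    have "sum_list xs = sum_list (butlast xs) + last xs"
      using ne by (metis append_butlast_last_id sum_list_append sum_list.Cons sum_list.Nil add.right_neutral)
    moreover have "sum_list (butlast xs) \<ge> 0"
      using pre[of "length xs - 1"] by (cases "length xs \<le> 1") (auto simp: butlast_conv_take)
    moreover have "last xs \<noteq> 0" using nz ne by (metis last_in_set)
    ultimately show ?thesis using sm by linarith
  qed
  let ?R = "runs xs"
  have R: "?R \<noteq> []" and hR: "hd (hd ?R) = hd xs" using hd_hd_runs[OF ne] by auto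
  have alt: "k < length ?R \<Longrightarrow> sgn (hd (?R ! k)) = (if even k then 1 else - 1)" for k
  proof (induction k)
    case 0
    then show ?case using hR R hd_pos by (simp flip: hd_conv_nth)
  next
    case (Suc k)
    have "?R ! Suc k \<in> set ?R" using Suc.prems by simp
    then have "hd (?R ! Suc k) \<in> set xs"
      using runs_nonempty concat_runs[of xs] by (metis UN_I hd_in_set set_concat)
    then have "hd (?R ! Suc k) \<noteq> 0" using nz by metis
    then show ?case using Suc runs_maximal[of k xs] by (auto simp: sgn_if split: if_splits)
  qed
  have l: "last ?R \<in> set ?R" "last ?R \<noteq> []" using R runs_nonempty last_in_set by blast+
  then have "sgn (hd (last ?R)) = sgn (last (last ?R))" by (intro runs_same_sign[of "last ?R" xs]) auto
  then have "sgn (hd (?R ! (length ?R - 1))) = - 1"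
    using last_last_runs[OF ne] last_neg last_conv_nth[OF R] by simp
  then show ?thesis using alt[of "length ?R - 1"] R by (cases "even (length ?R)") auto
qed

end

theory Submission
  imports Defs
begin

text \<open>The order of the entries within a run is irrelevant: a sub-collection is generalized Catalan
  as soon as it sums to zero and its partial sums at the run boundaries are nonnegative.

  Consume the entries of an irreducible list one at a time, starting with a positive one and
  cancelling positive units against later negative ones. At each moment a single entry is partially
  used; it lies in some run \<open>k\<close> and has a leftover \<open>s \<noteq> 0\<close> of the sign of that run. If \<open>s > 0\<close>, cancel it
  next against an unused entry of the first possible later negative run; if \<open>s < 0\<close>, against an
  unused entry of the last possible earlier positive run. This choice keeps what remains
  generalized Catalan. If the state \<open>(k, s)\<close> recurred, the entries consumed between the two
  occurrences and their complement would both be generalized Catalan, because exchanging two equal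
  leftovers in one run does not affect the sums at run boundaries. Hence the \<open>width - 1\<close> states before
  the last step are distinct, and there are fewer than \<open>cost\<close> of them, since a negative entry is
  never entirely unused when it becomes the partial one.\<close>

section \<open>Weighted sets with a rank function\<close>

text \<open>Stands for a list with the order inside each run forgotten: \<open>V\<close> is the set
  of positions, \<open>x\<close> gives the entries and \<open>r\<close> the index of the
  run.\<close>

locale ranked_weights =
  fixes V :: "'a set" and x :: "'a \<Rightarrow> int" and r :: "'a \<Rightarrow> nat"
  assumes finite_V: "finite V"
    and nonzero: "v \<in> V \<Longrightarrow> x v \<noteq> 0"
    and same_sign: "u \<in> V \<Longrightarrow> v \<in> V \<Longrightarrow> r u = r v \<Longrightarrow> sgn (x u) = sgn (x v)"
begin

definition below :: "'a set \<Rightarrow> nat \<Rightarrow> int" where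
  "below A K = (\<Sum>v\<in>{v\<in>A. r v < K}. x v)"

text \<open>Holds for the empty set, unlike the generalized Catalan property, so nonemptiness is
  stated separately later on.\<close>

definition balanced :: "'a set \<Rightarrow> bool" where
  "balanced A \<longleftrightarrow> sum x A = 0 \<and> (\<forall>K. 0 \<le> below A K)"

text \<open>The share that an amount \<open>s\<close> placed at rank \<open>k\<close> has in the
  boundary sum \<open>below\<close> at \<open>K\<close>.\<close>

definition atom :: "nat \<Rightarrow> int \<Rightarrow> nat \<Rightarrow> int" where
  "atom k s K = (if k < K then s else 0)"

text \<open>\<open>Z\<close> is the set of consumed entries and \<open>k\<close> the rank of the partially used one, whose leftover
  is necessarily \<open>sum x Z\<close>. The last two conditions say that the flow so far, and what remains
  together with the leftover, have nonnegative partial sums.\<close>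

definition walk_state :: "'a set \<Rightarrow> nat \<Rightarrow> bool" where
  "walk_state Z k \<longleftrightarrow> Z \<subseteq> V \<and> Z \<noteq> {} \<and>
     (\<exists>u\<in>Z. r u = k \<and> sgn (x u) = sgn (sum x Z) \<and> \<bar>sum x Z\<bar> \<le> \<bar>x u\<bar> \<and>
        (sum x Z < 0 \<longrightarrow> \<bar>sum x Z\<bar> < \<bar>x u\<bar>)) \<and>
     (\<forall>K. atom k (sum x Z) K \<le> below Z K) \<and>
     (\<forall>K. 0 \<le> below (V - Z) K + atom k (sum x Z) K)"

lemma finite_sub: "A \<subseteq> V \<Longrightarrow> finite A"
  using finite_V finite_subset by blast

lemma below_insert:
  assumes "A \<subseteq> V" "v \<notin> A"
  shows "below (insert v A) K = below A K + atom (r v) (x v) K"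
proof -
  have "{u \<in> insert v A. r u < K} =
      (if r v < K then insert v {u \<in> A. r u < K} else {u \<in> A. r u < K})"
    by auto
  then show ?thesis
    using assms finite_sub[OF assms(1)] by (auto simp: below_def atom_def)
qed

lemma below_diff:
  assumes "B \<subseteq> A" "A \<subseteq> V"
  shows "below (A - B) K = below A K - below B K"
proof -
  have "{v \<in> A - B. r v < K} = {v \<in> A. r v < K} - {v \<in> B. r v < K}" by auto
  then show ?thesis
    unfolding below_def using assms finite_sub[OF assms(2)] by (auto intro!: sum_diff)
qed

lemma below_eq_sum:
  obtains K where "k < K" "\<And>A. A \<subseteq> V \<Longrightarrow> below A K = sum x A"
proof
  \<comment> \<open>The sum of all ranks is a crude bound on each of them.\<close>
  define K where "K = Suc (k + sum r V)"
  show "k < K" by (simp add: K_def)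
  have "r v < K" if "v \<in> V" for v
    using member_le_sum[of v V r] that finite_V by (simp add: K_def)
  then show "below A K = sum x A" if "A \<subseteq> V" for A
    unfolding below_def using that by (intro sum.cong) auto
qed

lemma below_mono:
  assumes "A \<subseteq> V" "K \<le> L" "\<And>v. v \<in> A \<Longrightarrow> K \<le> r v \<Longrightarrow> r v < L \<Longrightarrow> 0 \<le> x v"
  shows "below A K \<le> below A L"
  unfolding below_def using assms finite_sub[OF assms(1)] by (intro sum_mono2) auto

lemma below_antimono:
  assumes "A \<subseteq> V" "K \<le> L" "\<And>v. v \<in> A \<Longrightarrow> K \<le> r v \<Longrightarrow> r v < L \<Longrightarrow> x v \<le> 0"
  shows "below A L \<le> below A K"
proof -
  have "(\<Sum>v\<in>{v\<in>A. r v < K}. - x v) \<le> (\<Sum>v\<in>{v\<in>A. r v < L}. - x v)"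
    using assms finite_sub[OF assms(1)] by (intro sum_mono2) auto
  then show ?thesis by (simp add: below_def sum_negf)
qed

section \<open>One step of the walk\<close>

lemma next_negative:
  assumes W: "walk_state Z k" and bal: "balanced V" and s: "sum x Z > 0"
  obtains v where "v \<in> V - Z" "x v < 0" "k < r v"
    "\<And>K. k < K \<Longrightarrow> K \<le> r v \<Longrightarrow> sum x Z \<le> below (V - Z) K + atom k (sum x Z) K"
proof -
  let ?N = "{v \<in> V - Z. x v < 0 \<and> k < r v}"
  have ZV: "Z \<subseteq> V" using W by (auto simp: walk_state_def)
  obtain u where "u \<in> V" "r u = k" "sgn (x u) = sgn (sum x Z)"
    using W by (auto simp: walk_state_def)
  then have u: "u \<in> V" "r u = k" "x u > 0" using s by (auto simp: sgn_if split: if_splits)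
  have R: "0 \<le> below (V - Z) K + atom k (sum x Z) K" for K
    using W by (auto simp: walk_state_def)
  \<comment> \<open>Rank \<open>k\<close> itself carries only positive entries, as \<open>u\<close>
    shows, and at boundary \<open>k\<close> the atom is still 0.\<close>
  have key: "0 \<le> below (V - Z) K" if "k < K" "\<And>v. v \<in> ?N \<Longrightarrow> K \<le> r v" for K
  proof -
    have "0 \<le> x v" if v: "v \<in> V - Z" "k \<le> r v" "r v < K" for v
    proof (cases "r v = k")
      case True
      then have "sgn (x v) = sgn (x u)" using same_sign[of v u] v u by auto
      then show ?thesis using u by (auto simp: sgn_if split: if_splits)
    next
      case False
      then show ?thesis using v \<open>\<And>v. v \<in> ?N \<Longrightarrow> K \<le> r v\<close>[of v] by force
    qed
    then have "below (V - Z) k \<le> below (V - Z) K"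
      using \<open>k < K\<close> by (intro below_mono) auto
    then show ?thesis using R[of k] by (simp add: atom_def)
  qed
  have "?N \<noteq> {}"
  proof
    assume N: "?N = {}"
    obtain K where K: "k < K" "\<And>A. A \<subseteq> V \<Longrightarrow> below A K = sum x A"
      using below_eq_sum by blast
    have "0 \<le> sum x (V - Z)" using key[of K] N K by auto
    moreover have "sum x (V - Z) = - sum x Z"
      using bal ZV finite_V by (simp add: balanced_def sum_diff)
    ultimately show False using s by simp
  qed
  moreover have fin: "finite ?N" using finite_V by simp
  ultimately have "Min (r ` ?N) \<in> r ` ?N" by (intro Min_in) auto
  then obtain v where v: "v \<in> ?N" "Min (r ` ?N) = r v" by (rule imageE)
  have min: "r v \<le> r w" if "w \<in> ?N" for w
    using v(2)[symmetric] that fin by simp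
  show thesis
  proof (rule that[of v])
    fix K assume "k < K" "K \<le> r v"
    then have "0 \<le> below (V - Z) K" using min by (intro key) (auto intro: order_trans)
    then show "sum x Z \<le> below (V - Z) K + atom k (sum x Z) K"
      using \<open>k < K\<close> by (simp add: atom_def)
  qed (use v in auto)
qed

lemma next_positive:
  assumes W: "walk_state Z k" and s: "sum x Z < 0"
  obtains v where "v \<in> V - Z" "x v > 0" "r v < k"
    "\<And>K. r v < K \<Longrightarrow> K \<le> k \<Longrightarrow> - sum x Z \<le> below (V - Z) K + atom k (sum x Z) K"
proof -
  let ?P = "{v \<in> V - Z. x v > 0 \<and> r v < k}"
  obtain u where "u \<in> V" "r u = k" "sgn (x u) = sgn (sum x Z)"
    using W by (auto simp: walk_state_def)
  then have u: "u \<in> V" "r u = k" "x u < 0" using s by (auto simp: sgn_if split: if_splits)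
  have R: "0 \<le> below (V - Z) K + atom k (sum x Z) K" for K
    using W by (auto simp: walk_state_def)
  have key: "- sum x Z \<le> below (V - Z) K" if "K \<le> k" "\<And>v. v \<in> ?P \<Longrightarrow> r v < K" for K
  proof -
    have "x v \<le> 0" if v: "v \<in> V - Z" "K \<le> r v" "r v < Suc k" for v
    proof (cases "r v = k")
      case True
      then have "sgn (x v) = sgn (x u)" using same_sign[of v u] v u by auto
      then show ?thesis using u by (auto simp: sgn_if split: if_splits)
    next
      case False
      then show ?thesis using v \<open>\<And>v. v \<in> ?P \<Longrightarrow> r v < K\<close>[of v] by force
    qed
    then have "below (V - Z) (Suc k) \<le> below (V - Z) K"
      using \<open>K \<le> k\<close> by (intro below_antimono) auto
    then show ?thesis using R[of "Suc k"] by (simp add: atom_def)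
  qed
  have "?P \<noteq> {}"
  proof
    assume "?P = {}"
    \<comment> \<open>Nothing lies before boundary 0, so without a candidate
      \<open>- sum x Z\<close> would be at most 0.\<close>
    then have "- sum x Z \<le> below (V - Z) 0" by (intro key) auto
    then show False using s by (simp add: below_def)
  qed
  moreover have fin: "finite ?P" using finite_V by simp
  ultimately have "Max (r ` ?P) \<in> r ` ?P" by (intro Max_in) auto
  then obtain v where v: "v \<in> ?P" "Max (r ` ?P) = r v" by (rule imageE)
  have max: "r w \<le> r v" if "w \<in> ?P" for w
    using v(2)[symmetric] that fin by simp
  show thesis
  proof (rule that[of v])
    fix K assume "r v < K" "K \<le> k"
    then have "- sum x Z \<le> below (V - Z) K"
      using max by (intro key) (auto intro: le_less_trans)
    then show "- sum x Z \<le> below (V - Z) K + atom k (sum x Z) K"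
      using \<open>K \<le> k\<close> by (simp add: atom_def)
  qed (use v in auto)
qed

lemma walk_step:
  assumes W: "walk_state Z k" and bal: "balanced V" and s: "sum x Z \<noteq> 0"
  obtains v k' where "v \<in> V - Z"
    "sum x (insert v Z) \<noteq> 0 \<Longrightarrow> walk_state (insert v Z) k'"
    "sum x (insert v Z) = 0 \<Longrightarrow> balanced (insert v Z) \<and> balanced (V - insert v Z)"
    "\<And>K. below Z K - atom k (sum x Z) K
      \<le> below (insert v Z) K - atom k' (sum x (insert v Z)) K"
proof -
  let ?s = "sum x Z"
  let ?R = "\<lambda>K. below (V - Z) K + atom k ?s K"
  have ZV: "Z \<subseteq> V" and R: "\<And>K. 0 \<le> ?R K" and U: "\<And>K. atom k ?s K \<le> below Z K"
    using W by (auto simp: walk_state_def)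
  obtain u where u: "u \<in> Z" "r u = k" "sgn (x u) = sgn ?s" "\<bar>?s\<bar> \<le> \<bar>x u\<bar>"
      "?s < 0 \<longrightarrow> \<bar>?s\<bar> < \<bar>x u\<bar>"
    using W by (auto simp: walk_state_def)
  obtain v where v: "v \<in> V - Z" "x v * ?s < 0"
    and room: "\<And>K. 0 < ?s \<Longrightarrow> k < r v \<and> (k < K \<longrightarrow> K \<le> r v \<longrightarrow> ?s \<le> ?R K)"
      "\<And>K. ?s < 0 \<Longrightarrow> r v < k \<and> (r v < K \<longrightarrow> K \<le> k \<longrightarrow> - ?s \<le> ?R K)"
  proof (cases "?s > 0")
    case True
    from next_negative[OF W bal True] obtain v where "v \<in> V - Z" "x v < 0" "k < r v"
      "\<And>K. k < K \<Longrightarrow> K \<le> r v \<Longrightarrow> ?s \<le> ?R K" by blast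
    with True show thesis by (intro that[of v]) (auto intro: mult_neg_pos)
  next
    case False
    with s have "?s < 0" by simp
    from next_positive[OF W this] obtain v where "v \<in> V - Z" "x v > 0" "r v < k"
      "\<And>K. r v < K \<Longrightarrow> K \<le> k \<Longrightarrow> - ?s \<le> ?R K" by blast
    with \<open>?s < 0\<close> show thesis by (intro that[of v]) (auto intro: mult_pos_neg)
  qed
  define s' where "s' = ?s + x v"
  \<comment> \<open>The sign of \<open>s'\<close> tells which of the two entries survives the
    cancellation. For \<open>s' = 0\<close> the choice is immaterial, since the atom
    vanishes.\<close>
  define k' where "k' = (if sgn s' = sgn ?s then k else r v)"
  \<comment> \<open>\<open>D K\<close> is the growth of the flow: the cancelled amount at boundaries
    between the two ranks, 0 at all others.\<close>
  define D where "D K = atom (r v) (x v) K + atom k ?s K - atom k' s' K" for K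
  have s': "sum x (insert v Z) = s'"
    using v ZV finite_sub[OF ZV] by (simp add: s'_def)
  have D: "0 \<le> D K \<and> D K \<le> ?R K" for K
  proof (cases "?s > 0")
    case True
    then have "x v < 0" using v by (simp add: mult_less_0_iff)
    then show ?thesis using True room(1)[of K] R[of K]
      by (auto simp: D_def k'_def s'_def atom_def sgn_if split: if_splits)
  next
    case False
    with s have "?s < 0" by simp
    moreover from this have "x v > 0" using v by (simp add: mult_less_0_iff)
    ultimately show ?thesis using room(2)[of K] R[of K]
      by (auto simp: D_def k'_def s'_def atom_def sgn_if split: if_splits)
  qed
  have bZ: "below (insert v Z) K = below Z K + atom (r v) (x v) K" for K
    using below_insert[of Z v] ZV v by auto
  have bR: "below (V - insert v Z) K = below (V - Z) K - atom (r v) (x v) K" for K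
  proof -
    have "insert v (V - insert v Z) = V - Z" using v by auto
    then show ?thesis using below_insert[of "V - insert v Z" v K] by auto
  qed
  have U': "atom k' s' K \<le> below (insert v Z) K" for K
    using U[of K] D[of K] by (simp add: bZ D_def)
  have R': "0 \<le> below (V - insert v Z) K + atom k' s' K" for K
    using D[of K] by (simp add: bR D_def)
  show thesis
  proof (rule that[of v k'])
    show "v \<in> V - Z" by fact
    show "below Z K - atom k ?s K \<le> below (insert v Z) K - atom k' (sum x (insert v Z)) K" for K
      using D[of K] unfolding s' by (simp add: bZ D_def)
  next
    assume "sum x (insert v Z) \<noteq> 0"
    then have n0: "s' \<noteq> 0" by (simp add: s')
    \<comment> \<open>The leftover belongs to \<open>u\<close> if the sign is kept and to
      \<open>v\<close> otherwise. Either way some of that entry has been cancelled, which gives the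
      strict bound.\<close>
    have "\<exists>w\<in>insert v Z. r w = k' \<and> sgn (x w) = sgn s' \<and> \<bar>s'\<bar> \<le> \<bar>x w\<bar> \<and>
        (s' < 0 \<longrightarrow> \<bar>s'\<bar> < \<bar>x w\<bar>)"
    proof (cases "sgn s' = sgn ?s")
      case True
      then show ?thesis using u v n0
        by (intro bexI[of _ u]) (auto simp: k'_def s'_def sgn_if mult_less_0_iff split: if_splits)
    next
      case False
      then show ?thesis using v n0 s
        by (intro bexI[of _ v]) (auto simp: k'_def s'_def sgn_if mult_less_0_iff split: if_splits)
    qed
    then show "walk_state (insert v Z) k'"
      unfolding walk_state_def s' using U' R' ZV v by auto
  next
    assume 0: "sum x (insert v Z) = 0"
    then have "sum x (V - insert v Z) = 0"
      using bal ZV v finite_V by (simp add: balanced_def sum_diff del: sum.insert)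
    then show "balanced (insert v Z) \<and> balanced (V - insert v Z)"
      using 0 U' R' by (auto simp: balanced_def s' atom_def)
  qed
qed

section \<open>Repeated states and the count\<close>

text \<open>Equal leftovers at the same rank give equal atoms. The complement consists of
  \<open>V - Z\<close> and \<open>Z'\<close>: the sums of \<open>V - Z\<close> are nonnegative once
  the atom is added, and those of \<open>Z'\<close> dominate the same atom.\<close>

lemma repeated_state_balanced:
  assumes bal: "balanced V" and W: "walk_state Z k" "walk_state Z' k"
    and sub: "Z' \<subset> Z" and eq: "sum x Z' = sum x Z"
    and le: "\<And>K. below Z' K \<le> below Z K"
  shows "balanced (Z - Z') \<and> balanced (V - (Z - Z')) \<and> Z - Z' \<noteq> {} \<and> V - (Z - Z') \<noteq> {}"
proof -
  have ZV: "Z \<subseteq> V" "Z' \<subseteq> V" "Z' \<noteq> {}" using W by (auto simp: walk_state_def)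
  have "below (Z - Z') K = below Z K - below Z' K" for K
    using below_diff sub ZV by blast
  moreover have "below (V - (Z - Z')) K = below (V - Z) K + below Z' K" for K
  proof -
    have "Z - Z' \<subseteq> V" using ZV by auto
    then show ?thesis
      using below_diff[of "Z - Z'" V K] below_diff[of Z V K] below_diff[of Z' Z K] sub ZV by auto
  qed
  moreover have "0 \<le> below (V - Z) K + below Z' K" for K
    using W eq unfolding walk_state_def by (smt (verit))
  moreover have "sum x (Z - Z') = 0"
    using eq sub ZV finite_sub[of Z] by (simp add: sum_diff psubset_imp_subset finite_sub)
  moreover from this have "sum x (V - (Z - Z')) = 0"
    using bal ZV finite_V sum_diff[of V "Z - Z'" x] by (auto simp: balanced_def)
  ultimately show ?thesis using le sub ZV unfolding balanced_def by auto
qed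

text \<open>Runs the walk for \<open>n\<close> steps from \<open>v0\<close>. \<open>T\<close>
  collects the pairs of rank and leftover met so far, each witnessed by a subset of \<open>Z\<close>
  with no larger flow; its cardinality records that no pair was repeated.\<close>

lemma distinct_walk_states:
  assumes bal: "balanced V"
    and irr: "\<And>A. A \<subseteq> V \<Longrightarrow> A \<noteq> {} \<Longrightarrow> A \<noteq> V \<Longrightarrow> balanced A \<Longrightarrow> \<not> balanced (V - A)"
    and pos: "v0 \<in> V" "x v0 > 0"
  shows "Suc n < card V \<Longrightarrow> \<exists>Z k T. walk_state Z k \<and> card Z = Suc n \<and> card T = Suc n \<and> finite T \<and>
    (\<forall>(k', s') \<in> T. \<exists>Z' \<subseteq> Z. walk_state Z' k' \<and> sum x Z' = s' \<and>
       (\<forall>K. below Z' K - atom k' s' K \<le> below Z K - atom k (sum x Z) K))"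
proof (induction n)
  case 0
  \<comment> \<open>All of \<open>v0\<close> is leftover at the start, so the flow is 0.\<close>
  have b: "below {v0} K = atom (r v0) (x v0) K" for K
    using below_insert[of "{}" v0 K] by (simp add: below_def)
  have "below (V - {v0}) K + atom (r v0) (x v0) K = below V K" for K
    using below_diff[of "{v0}" V K] pos b by simp
  then have "walk_state {v0} (r v0)"
    using bal pos b by (auto simp: walk_state_def balanced_def)
  then show ?case
    by (intro exI[of _ "{v0}"] exI[of _ "r v0"] exI[of _ "{(r v0, x v0)}"]) auto
next
  case (Suc n)
  then obtain Z k T where W: "walk_state Z k" and cZ: "card Z = Suc n"
    and cT: "card T = Suc n" "finite T"
    and T: "\<And>k' s'. (k', s') \<in> T \<Longrightarrow> \<exists>Z' \<subseteq> Z. walk_state Z' k' \<and> sum x Z' = s' \<and>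
       (\<forall>K. below Z' K - atom k' s' K \<le> below Z K - atom k (sum x Z) K)"
    by fastforce
  have ZV: "Z \<subseteq> V" "Z \<noteq> {}" using W by (auto simp: walk_state_def)
  have "sum x Z \<noteq> 0"
    using W ZV nonzero by (auto simp: walk_state_def sgn_0_0)
  then obtain v k' where v: "v \<in> V - Z"
    and W': "sum x (insert v Z) \<noteq> 0 \<Longrightarrow> walk_state (insert v Z) k'"
    and B: "sum x (insert v Z) = 0 \<Longrightarrow> balanced (insert v Z) \<and> balanced (V - insert v Z)"
    and le: "\<And>K. below Z K - atom k (sum x Z) K
      \<le> below (insert v Z) K - atom k' (sum x (insert v Z)) K"
    using walk_step[OF W bal] by blast
  let ?Z = "insert v Z"
  let ?l = "(k', sum x ?Z)"
  have cZ': "card ?Z = Suc (Suc n)" using v cZ ZV finite_sub[of Z] by simp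
  \<comment> \<open>A zero leftover would split \<open>V\<close> into two balanced parts, both
    nonempty because not all entries are consumed yet.\<close>
  have ne: "sum x ?Z \<noteq> 0"
  proof
    assume "sum x ?Z = 0"
    moreover have "?Z \<noteq> V" using cZ' Suc.prems by auto
    ultimately show False using irr[of ?Z] B v ZV by auto
  qed
  note W' = W'[OF ne]
  have T': "\<exists>Z' \<subseteq> Z. walk_state Z' j \<and> sum x Z' = s \<and>
      (\<forall>K. below Z' K - atom j s K \<le> below ?Z K - atom k' (sum x ?Z) K)" if "(j, s) \<in> T" for j s
  proof -
    from T[OF that] obtain Z' where Z': "Z' \<subseteq> Z" "walk_state Z' j" "sum x Z' = s"
      "\<And>K. below Z' K - atom j s K \<le> below Z K - atom k (sum x Z) K" by blast
    show ?thesis using Z'(1-3) order_trans[OF Z'(4) le] by blast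
  qed
  \<comment> \<open>A pair met before has the same atom, so the flow inequality becomes one between
    values of \<open>below\<close>, and the entries consumed in between split
    \<open>V\<close>.\<close>
  have "?l \<notin> T"
  proof
    assume "?l \<in> T"
    from T'[OF this] obtain Z' where Z': "Z' \<subseteq> Z" "walk_state Z' k'" "sum x Z' = sum x ?Z"
      "\<And>K. below Z' K \<le> below ?Z K" by auto
    then have "Z' \<subset> ?Z" using v by auto
    from repeated_state_balanced[OF bal W' Z'(2) this Z'(3,4)] irr[of "?Z - Z'"] v ZV
    show False by auto
  qed
  then have "card (insert ?l T) = Suc (Suc n)" using cT by simp
  then show ?case
  proof (intro exI conjI)
    show "\<forall>(j, s) \<in> insert ?l T. \<exists>Z' \<subseteq> ?Z. walk_state Z' j \<and> sum x Z' = s \<and>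
        (\<forall>K. below Z' K - atom j s K \<le> below ?Z K - atom k' (sum x ?Z) K)"
    proof clarify
      fix j s assume "(j, s) \<in> insert ?l T"
      then consider "j = k'" "s = sum x ?Z" | "(j, s) \<in> T" by auto
      then show "\<exists>Z' \<subseteq> ?Z. walk_state Z' j \<and> sum x Z' = s \<and>
          (\<forall>K. below Z' K - atom j s K \<le> below ?Z K - atom k' (sum x ?Z) K)"
      proof cases
        case 1
        then show ?thesis using W' by blast
      next
        case 2
        then show ?thesis using T'[OF 2] by blast
      qed
    qed
  qed (use W' cZ' cT in auto)
qed

text \<open>The walk yields \<open>card V - 1\<close> distinct pairs. A positive rank
  \<open>j\<close> admits at most \<open>a j\<close> leftovers, a negative one at most
  \<open>a j - 1\<close>; since a negative rank occurs, fewer than \<open>sum a {..<N}\<close> pairs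
  are possible.\<close>

lemma card_le_sum_bounds:
  fixes a :: "nat \<Rightarrow> nat"
  assumes bal: "balanced V" and "V \<noteq> {}"
    and irr: "\<And>A. A \<subseteq> V \<Longrightarrow> A \<noteq> {} \<Longrightarrow> A \<noteq> V \<Longrightarrow> balanced A \<Longrightarrow> \<not> balanced (V - A)"
    and rank: "\<And>v. v \<in> V \<Longrightarrow> r v < N" and bound: "\<And>v. v \<in> V \<Longrightarrow> \<bar>x v\<bar> \<le> int (a (r v))"
  shows "card V \<le> sum a {..<N}"
proof -
  have "\<exists>v\<in>V. x v > 0"
  proof (rule ccontr)
    assume "\<not> ?thesis"
    then have "(\<Sum>v\<in>V. - x v) > 0"
      using finite_V \<open>V \<noteq> {}\<close> nonzero by (intro sum_pos) force+
    then show False using bal by (simp add: balanced_def sum_negf)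
  qed
  then obtain p where p: "p \<in> V" "x p > 0" by blast
  have "\<exists>v\<in>V. x v < 0"
  proof (rule ccontr)
    assume "\<not> ?thesis"
    then have "sum x V > 0"
      using finite_V \<open>V \<noteq> {}\<close> nonzero by (intro sum_pos) force+
    then show False using bal by (simp add: balanced_def)
  qed
  then obtain m where m: "m \<in> V" "x m < 0" by blast
  have "card {p, m} \<le> card V" using p m finite_V by (intro card_mono) auto
  moreover have "p \<noteq> m" using p m by auto
  ultimately have "2 \<le> card V" by simp
  then obtain n where n: "card V = Suc (Suc n)"
    using le_Suc_ex[of 2 "card V"] by auto
  obtain T where T: "card T = Suc n" "\<And>k s. (k, s) \<in> T \<Longrightarrow> \<exists>Z. walk_state Z k \<and> sum x Z = s"
  proof -
    have "Suc n < card V" using n by simp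
    from distinct_walk_states[OF bal irr p this] obtain Z k T where T: "card T = Suc n"
      and *: "\<forall>(k', s') \<in> T. \<exists>Z' \<subseteq> Z. walk_state Z' k' \<and> sum x Z' = s' \<and>
       (\<forall>K. below Z' K - atom k' s' K \<le> below Z K - atom k (sum x Z) K)"
      by blast
    have "\<exists>Z. walk_state Z k \<and> sum x Z = s" if "(k, s) \<in> T" for k s
      using bspec[OF * that] by auto
    then show thesis using that[OF T] by blast
  qed
  \<comment> \<open>A negative rank loses the value \<open>- int (a j)\<close> by the strict bound
    in \<open>walk_state\<close>. Ranks without entries fall into the second case and are merely
    overcounted.\<close>
  define S where "S j = (if \<exists>v\<in>V. r v = j \<and> x v < 0 then {- int (a j) <..< 0} else {0 <.. int (a j)})"
    for j
  have "T \<subseteq> Sigma {..<N} S"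
  proof clarify
    fix k s assume "(k, s) \<in> T"
    then obtain Z where Z: "walk_state Z k" "sum x Z = s" using T by blast
    then obtain u where u: "u \<in> V" "r u = k" "sgn (x u) = sgn s" "\<bar>s\<bar> \<le> \<bar>x u\<bar>"
        "s < 0 \<longrightarrow> \<bar>s\<bar> < \<bar>x u\<bar>"
      by (auto simp: walk_state_def)
    have iff: "(\<exists>v\<in>V. r v = k \<and> x v < 0) \<longleftrightarrow> x u < 0"
      using same_sign[OF _ u(1)] u by (metis sgn_less)
    show "k \<in> {..<N} \<and> s \<in> S k"
      using u nonzero[OF u(1)] rank[OF u(1)] bound[OF u(1)] unfolding S_def iff
      by (auto simp: sgn_if split: if_splits)
  qed
  moreover have "finite (Sigma {..<N} S)" by (auto simp: S_def)
  ultimately have "Suc n \<le> card (Sigma {..<N} S)" using T by (metis card_mono)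
  also have "\<dots> = (\<Sum>j<N. card (S j))" by (intro card_SigmaI) (auto simp: S_def)
  also have "\<dots> < sum a {..<N}"
  proof (rule sum_strict_mono_ex1)
    show "\<forall>j\<in>{..<N}. card (S j) \<le> a j" by (auto simp: S_def)
    have "0 < a (r m)" using bound[OF m(1)] m by (auto intro: Suc_leI)
    then have "card (S (r m)) < a (r m)" using m by (auto simp: S_def)
    then show "\<exists>j\<in>{..<N}. card (S j) < a j" using rank[OF m(1)] by blast
  qed simp
  finally show ?thesis using n by simp
qed

end

section \<open>Passing between lists and ranked sets of positions\<close>

lemma sum_list_nths_take:
  fixes xs :: "'a::comm_monoid_add list"
  assumes "p \<le> length xs"
  shows "sum_list (nths (take p xs) A) = (\<Sum>v\<in>{v\<in>A. v < p}. xs ! v)"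
  using assms
proof (induction p)
  case 0
  then show ?case by simp
next
  case (Suc p)
  have "{v \<in> A. v < Suc p} = (if p \<in> A then insert p {v \<in> A. v < p} else {v \<in> A. v < p})"
    by (auto simp: less_Suc_eq)
  then show ?case
    using Suc by (simp add: take_Suc_conv_app_nth nths_append add.commute)
qed

text \<open>Together with \<open>sum_list_nths_take\<close>, turns a prefix sum of a sublist into a
  sum over the chosen positions below some \<open>p\<close>.\<close>

lemma take_nths: "\<exists>p \<le> length xs. take q (nths xs A) = nths (take p xs) A"
proof (induction xs rule: rev_induct)
  case Nil
  then show ?case by simp
next
  case (snoc y ys)
  show ?case
  proof (cases "q \<le> length (nths ys A)")
    case True
    with snoc obtain p where "p \<le> length ys" "take q (nths ys A) = nths (take p ys) A" by blast
    with True show ?thesis by (intro exI[of _ p]) (simp add: nths_append)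
  next
    case False
    \<comment> \<open>The entry \<open>y\<close> adds at most one element, so \<open>take q\<close>
      keeps everything.\<close>
    then show ?thesis by (intro exI[of _ "Suc (length ys)"]) (auto simp: nths_append)
  qed
qed

text \<open>Provides the rank: when \<open>rs\<close> is the list of runs, \<open>r\<close> serves
  as the run index of a position.\<close>

lemma concat_index:
  "\<exists>r. mono_on {..<length (concat rs)} r \<and>
     (\<forall>v < length (concat rs). r v < length rs \<and> concat rs ! v \<in> set (rs ! r v))"
proof (induction rs)
  case Nil
  then show ?case by (auto simp: mono_on_def)
next
  case (Cons l rs)
  then obtain r where r: "mono_on {..<length (concat rs)} r"
    "\<And>v. v < length (concat rs) \<Longrightarrow> r v < length rs \<and> concat rs ! v \<in> set (rs ! r v)" by blast
  define r' where "r' v = (if v < length l then 0 else Suc (r (v - length l)))" for v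
  have "mono_on {..<length (concat (l # rs))} r'"
    using r(1) by (auto simp: r'_def intro!: mono_onI mono_onD[OF r(1)])
  moreover have "r' v < length (l # rs) \<and> concat (l # rs) ! v \<in> set ((l # rs) ! r' v)"
    if "v < length (concat (l # rs))" for v
    using r(2)[of "v - length l"] that by (auto simp: r'_def nth_append)
  ultimately show ?case by blast
qed

lemma initial_segment_nat:
  fixes S :: "nat set"
  assumes "finite S" and down: "\<And>u v. u \<le> v \<Longrightarrow> v \<in> S \<Longrightarrow> u \<in> S"
  obtains p where "S = {..<p}"
proof
  let ?p = "LEAST p. p \<notin> S"
  obtain q where "q \<notin> S" using ex_new_if_finite[OF infinite_UNIV_nat \<open>finite S\<close>] by blast
  then have "?p \<notin> S" by (rule LeastI)
  then have "v < ?p" if "v \<in> S" for v using down[of ?p v] that by (cases "v < ?p") auto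
  moreover have "v \<in> S" if "v < ?p" for v using not_less_Least[OF that] by blast
  ultimately show "S = {..<?p}" by blast
qed

context
  fixes xs :: "int list" and r :: "nat \<Rightarrow> nat"
  assumes mono: "mono_on {..<length xs} r"
    and ranked: "ranked_weights {..<length xs} (nth xs) r"
begin

interpretation ranked_weights "{..<length xs}" "nth xs" r by (fact ranked)

text \<open>By monotonicity of \<open>r\<close> the positions of rank below \<open>K\<close> form a
  prefix, so each boundary sum is a prefix sum of the list.\<close>

lemma balanced_if_catalan:
  assumes "generalized_catalan xs"
  shows "balanced {..<length xs}"
  unfolding balanced_def
proof (intro conjI allI)
  show "sum ((!) xs) {..<length xs} = 0"
    using assms by (simp add: generalized_catalan_def sum_list_sum_nth atLeast0LessThan)
  fix K
  let ?S = "{v \<in> {..<length xs}. r v < K}"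
  obtain p where S: "?S = {..<p}"
  proof (rule initial_segment_nat[of ?S])
    show "u \<in> ?S" if "u \<le> v" "v \<in> ?S" for u v
      using mono_onD[OF mono, of u v] that by auto
  qed simp
  have "{..<p} \<subseteq> {..<length xs}" unfolding S[symmetric] by blast
  then have p: "p \<le> length xs" by simp
  then have "0 \<le> sum_list (take p xs)"
    using assms by (cases "p = 0") (auto simp: generalized_catalan_def)
  also have "sum_list (take p xs) = sum (nth xs) {..<p}"
    using p by (simp add: sum_list_sum_nth atLeast0LessThan min_def)
  finally show "0 \<le> below {..<length xs} K"
    unfolding below_def S .
qed

text \<open>Within a run of \<open>A\<close> the partial sums are monotone, so they are bounded below by the value at
  one of the two ends of the run.\<close>

lemma catalan_if_balanced:
  assumes bal: "balanced A" and A: "A \<subseteq> {..<length xs}" "A \<noteq> {}"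
  shows "generalized_catalan (nths xs A)"
proof -
  have fin: "finite A" using A finite_sub by blast
  have nonneg: "0 \<le> (\<Sum>v\<in>{v\<in>A. v < p}. xs ! v)" if p: "p \<le> length xs" for p
  proof (cases p)
    case 0
    then show ?thesis by simp
  next
    case (Suc q)
    let ?k = "r q"
    have lt: "v < q" if "v < length xs" "r v < ?k" for v
      using mono_onD[OF mono, of q v] that p Suc by (cases "v < q") auto
    have le: "r v \<le> ?k" if "v \<le> q" for v
      using mono_onD[OF mono, of v q] that p Suc by auto
    have same: "sgn (xs ! v) = sgn (xs ! q)" if "v < length xs" "r v = ?k" for v
      using same_sign[of v q] that p Suc by auto
    have b: "0 \<le> below A K" for K using bal by (simp add: balanced_def)
    show ?thesis
    \<comment> \<open>Position \<open>q\<close> ends the prefix and need not lie in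
      \<open>A\<close>; its sign is that of its run. The boundary before a positive run, or after a
      negative one, gives the lower bound.\<close>
    proof (cases "xs ! q > 0")
      case True
      have "below A ?k \<le> (\<Sum>v\<in>{v\<in>A. v < p}. xs ! v)"
        unfolding below_def
      proof (rule sum_mono2)
        show "{v \<in> A. r v < ?k} \<subseteq> {v \<in> A. v < p}" using lt A Suc by fastforce
        show "0 \<le> xs ! v" if "v \<in> {v \<in> A. v < p} - {v \<in> A. r v < ?k}" for v
          using that same[of v] le[of v] A True Suc
          by (auto simp: sgn_if less_Suc_eq_le split: if_splits)
      qed (use fin in simp)
      then show ?thesis using b[of ?k] by simp
    next
      case False
      have "(\<Sum>v\<in>{v\<in>A. v < p}. - xs ! v) \<le> (\<Sum>v\<in>{v\<in>A. r v < Suc ?k}. - xs ! v)"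
      proof (rule sum_mono2)
        show "{v \<in> A. v < p} \<subseteq> {v \<in> A. r v < Suc ?k}" using le Suc by (auto simp: less_Suc_eq_le)
        show "0 \<le> - xs ! v" if "v \<in> {v \<in> A. r v < Suc ?k} - {v \<in> A. v < p}" for v
        proof -
          have "v < length xs" "r v \<le> ?k" "\<not> v < q" using that A Suc by auto
          then have "sgn (xs ! v) = sgn (xs ! q)" using lt[of v] by (intro same) (auto simp: less_le)
          then show ?thesis using False by (auto simp: sgn_if split: if_splits)
        qed
      qed (use fin in simp)
      then show ?thesis using b[of "Suc ?k"] by (simp add: below_def sum_negf)
    qed
  qed
  have "0 \<le> sum_list (take q (nths xs A))" for q
    using take_nths[of xs q A] sum_list_nths_take[of _ xs A] nonneg by metis
  moreover have "sum_list (nths xs A) = 0"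
  proof -
    have "{v \<in> A. v < length xs} = A" using A by auto
    then show ?thesis
      using sum_list_nths_take[of "length xs" xs A] bal by (simp add: balanced_def)
  qed
  moreover have "0 \<notin> set (nths xs A)"
    using nonzero by (force simp: set_nths)
  moreover have "nths xs A \<noteq> []"
    using A by (auto simp: set_nths simp flip: set_empty)
  ultimately show ?thesis by (simp add: generalized_catalan_def)
qed

end

section \<open>The count applied to the runs of a list\<close>

theorem theorem1p1:
  fixes xs :: "int list"
  assumes "generalized_catalan xs"
    and "cost xs < int (width xs)"
  shows "reducible xs"
proof (rule ccontr)
  assume irr: "\<not> reducible xs"
  let ?V = "{..<length xs}"
  let ?a = "\<lambda>k. Max (abs ` set (runs xs ! k))"
  obtain r where mono: "mono_on ?V r"
    and r: "\<And>v. v < length xs \<Longrightarrow> r v < length (runs xs) \<and> xs ! v \<in> set (runs xs ! r v)"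
    using concat_index[of "runs xs"] unfolding concat_runs by blast
  have ranked: "ranked_weights ?V (nth xs) r"
  proof
    show "xs ! v \<noteq> 0" if "v \<in> ?V" for v
      using assms(1) that by (auto simp: generalized_catalan_def in_set_conv_nth)
    show "sgn (xs ! u) = sgn (xs ! v)" if "u \<in> ?V" "v \<in> ?V" "r u = r v" for u v
      using r[of u] r[of v] that by (intro runs_same_sign[of "runs xs ! r v" xs]) auto
  qed simp
  interpret ranked_weights ?V "nth xs" r by (fact ranked)
  \<comment> \<open>The count takes natural bounds, so the run maxima pass through
    \<open>nat\<close>; nonnegativity makes this lossless.\<close>
  have a: "0 \<le> ?a k" if "k < length (runs xs)" for k
  proof -
    have "runs xs ! k \<noteq> []" using that by (intro runs_nonempty[of _ xs]) simp
    then have "\<bar>hd (runs xs ! k)\<bar> \<le> ?a k" by (intro Max_ge) auto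
    then show ?thesis by linarith
  qed
  have "card ?V \<le> (\<Sum>k<length (runs xs). nat (?a k))"
  proof (rule card_le_sum_bounds)
    show "balanced ?V" by (rule balanced_if_catalan[OF mono ranked assms(1)])
    show "?V \<noteq> {}" using assms(1) by (auto simp: generalized_catalan_def)
    \<comment> \<open>\<open>A \<noteq> ?V\<close> makes the complement nonempty, so both parts
      would give generalized Catalan sublists.\<close>
    show "\<not> balanced (?V - A)" if "A \<subseteq> ?V" "A \<noteq> {}" "A \<noteq> ?V" "balanced A" for A
      using that irr catalan_if_balanced[OF mono ranked] unfolding reducible_def
      by (metis Diff_eq_empty_iff Diff_subset subset_antisym)
    show "r v < length (runs xs)" if "v \<in> ?V" for v using r that by simp
    show "\<bar>xs ! v\<bar> \<le> int (nat (?a (r v)))" if "v \<in> ?V" for v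
    proof -
      have "\<bar>xs ! v\<bar> \<le> ?a (r v)" using r[of v] that by (intro Max_ge) auto
      then show ?thesis by linarith
    qed
  qed
  then have "int (length xs) \<le> (\<Sum>k<length (runs xs). int (nat (?a k)))"
    unfolding card_lessThan of_nat_sum[symmetric] of_nat_le_iff .
  also have "\<dots> = (\<Sum>k<length (runs xs). ?a k)" using a by (intro sum.cong) auto
  also have "\<dots> = cost xs" by (simp add: cost_def sum_list_sum_nth atLeast0LessThan)
  finally show False using assms(2) by (simp add: width_def)
qed

end
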